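(* Let $\lambda_0,\lambda_1,c_0,c_1\in\mathbb{R}$ and $p_0,p_1\in(0,1)$. Let $\{V(n)\}_{n\in\mathbb{Z}}$ be a sequence of independent random variables such that $V(n)=\lambda_0\xi_n+c_0$ for even $n$ and $V(n)=\lambda_1\xi_n+c_1$ for odd $n$, where $\xi_n$ is a Bernoulli random variable taking the value $1$ with probability $p_0$ (for $n$ even), respectively $p_1$ (for $n$ odd), and the value $0$ otherwise. Let $H_V$ be the discrete Schrödinger operator on $\ell^2(\mathbb{Z})$ given by $(H_V\phi)(n)=\phi(n+1)+\phi(n-1)+V(n)\phi(n)$. Then the almost sure spectrum $\sigma_{as}(H_V)$ consists of at most $4$ closed intervals.
   Context: The spectrum of a bounded operator $H$ is $\sigma(H)=\{E\in\mathbb{R}: H-E \text{ has no bounded inverse}\}$. For this random family there is a deterministic set $\sigma_{as}(H_V)\subset\mathbb{R}$, the almost sure spectrum, such that $\sigma(H_V)=\sigma_{as}(H_V)$ for almost every realization of the potential. *)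

theory Defs
  imports "HOL-Probability.Probability"
begin

definition l2 :: "(int \<Rightarrow> complex) set" where
  "l2 = {\<phi>. (\<lambda>n. (cmod (\<phi> n))\<^sup>2) summable_on UNIV}"

definition l2norm :: "(int \<Rightarrow> complex) \<Rightarrow> real" where
  "l2norm \<phi> = sqrt (infsum (\<lambda>n. (cmod (\<phi> n))\<^sup>2) UNIV)"

definition schrod :: "(int \<Rightarrow> real) \<Rightarrow> (int \<Rightarrow> complex) \<Rightarrow> (int \<Rightarrow> complex)" where
  "schrod V \<phi> = (\<lambda>n. \<phi> (n + 1) + \<phi> (n - 1) + complex_of_real (V n) * \<phi> n)"

definition has_bounded_inverse_l2 :: "((int \<Rightarrow> complex) \<Rightarrow> (int \<Rightarrow> complex)) \<Rightarrow> bool" where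
  "has_bounded_inverse_l2 T \<longleftrightarrow>
     (\<exists>G. (\<forall>\<psi>\<in>l2. G \<psi> \<in> l2) \<and>
          (\<exists>C. \<forall>\<psi>\<in>l2. l2norm (G \<psi>) \<le> C * l2norm \<psi>) \<and>
          (\<forall>\<phi>\<in>l2. G (T \<phi>) = \<phi>) \<and>
          (\<forall>\<psi>\<in>l2. T (G \<psi>) = \<psi>))"

definition schrod_spectrum :: "(int \<Rightarrow> real) \<Rightarrow> real set" where
  "schrod_spectrum V =
     {E. \<not> has_bounded_inverse_l2 (\<lambda>\<phi>. \<lambda>n. schrod V \<phi> n - complex_of_real E * \<phi> n)}"

end

theory Submission
  imports Defs
begin

text \<open>
  The almost sure spectrum is the union of the spectra of the four two-periodic operators that take
  a fixed value \<open>a \<in> {c0, c0 + lam0}\<close> on even and a fixed value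
  \<open>b \<in> {c1, c1 + lam1}\<close> on odd sites, that is,
  the set of all \<open>E\<close> with \<open>0 \<le> (E - a) * (E - b) \<le> 4\<close> for some such \<open>a\<close>, \<open>b\<close>.
  If \<open>E\<close> is not in this set, then the entries \<open>W n\<close> of the diagonal of \<open>H - E\<close> satisfy
  \<open>W n * W (n + 1) < 0\<close> or \<open>W n * W (n + 1) > 4\<close>. Multiplying \<open>H - E\<close> by the sign of \<open>W\<close>
  makes it coercive: hopping across an edge with opposite signs only contributes to the imaginary
  part of the quadratic form, and hopping across the other edges is dominated by the diagonal.
  Conversely, almost surely every pattern \<open>a, b, a, b, \<dots>\<close> occurs on arbitrarily long blocks, and
  truncated Bloch waves show that \<open>H - E\<close> has no bounded inverse.
  Finally, each of the eight bands has one of the four points \<open>a\<close>, \<open>b\<close> as an endpoint, so that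
  at most four connected components remain.
\<close>

subsection \<open>Square summable sequences\<close>

lemma L2_set_le_l2norm:
  assumes "\<phi> \<in> l2" "finite F"
  shows "L2_set (\<lambda>n. cmod (\<phi> n)) F \<le> l2norm \<phi>"
  using assms unfolding L2_set_def l2norm_def l2_def
  by (intro real_sqrt_le_mono finite_sum_le_infsum) auto

text \<open>A family of nonnegative terms is summable as soon as its finite partial sums are
  bounded, and its sum is at most that bound. So finite-dimensional inequalities for
  \<open>L2_set\<close>, such as Minkowski's, carry over to \<open>l2\<close>.\<close>

lemma l2_boundI:
  assumes "\<And>F. finite F \<Longrightarrow> L2_set (\<lambda>n. cmod (\<phi> n)) F \<le> B"
  shows "\<phi> \<in> l2" "l2norm \<phi> \<le> B"
proof -
  have B: "0 \<le> B" using assms[of "{}"] by simp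
  have *: "(\<Sum>n\<in>F. (cmod (\<phi> n))\<^sup>2) \<le> B\<^sup>2" if "finite F" for F
    using assms[OF that] B unfolding L2_set_def by (simp add: sqrt_le_D)
  have S: "(\<lambda>n. (cmod (\<phi> n))\<^sup>2) summable_on UNIV"
    by (rule nonneg_bdd_above_summable_on) (auto intro!: bdd_aboveI[where M="B\<^sup>2"] *)
  then show "\<phi> \<in> l2" by (simp add: l2_def)
  have "infsum (\<lambda>n. (cmod (\<phi> n))\<^sup>2) UNIV \<le> B\<^sup>2"
    by (rule infsum_le_finite_sums[OF S]) (use * in auto)
  then show "l2norm \<phi> \<le> B" unfolding l2norm_def using B by (simp add: real_le_lsqrt)
qed

lemma l2norm_nonneg: "0 \<le> l2norm \<phi>"
  by (simp add: l2norm_def infsum_nonneg)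

lemma l2norm_power2: "(l2norm \<phi>)\<^sup>2 = (\<Sum>\<^sub>\<infinity>n. (cmod (\<phi> n))\<^sup>2)"
  by (simp add: l2norm_def infsum_nonneg)

lemma cmod_le_l2norm:
  assumes "\<phi> \<in> l2" shows "cmod (\<phi> n) \<le> l2norm \<phi>"
  using L2_set_le_l2norm[OF assms, of "{n}"] by (simp add: L2_set_def)

lemma l2norm_zero: "(\<lambda>_. 0) \<in> l2" "l2norm (\<lambda>_. 0) = 0"
  by (auto simp: l2_def l2norm_def)

lemma l2norm_eq_0D:
  assumes "\<phi> \<in> l2" "l2norm \<phi> \<le> 0" shows "\<phi> = (\<lambda>_. 0)"
proof
  fix n show "\<phi> n = 0" using cmod_le_l2norm[OF assms(1), of n] assms(2)
    by (metis norm_le_zero_iff order_trans)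
qed

lemma l2_add:
  assumes "\<phi> \<in> l2" "\<psi> \<in> l2"
  shows "(\<lambda>n. \<phi> n + \<psi> n) \<in> l2" "l2norm (\<lambda>n. \<phi> n + \<psi> n) \<le> l2norm \<phi> + l2norm \<psi>"
proof -
  have "L2_set (\<lambda>n. cmod (\<phi> n + \<psi> n)) F \<le> l2norm \<phi> + l2norm \<psi>" if F: "finite F" for F
  proof -
    have "L2_set (\<lambda>n. cmod (\<phi> n + \<psi> n)) F \<le> L2_set (\<lambda>n. cmod (\<phi> n) + cmod (\<psi> n)) F"
      by (intro L2_set_mono norm_triangle_ineq) auto
    also have "\<dots> \<le> L2_set (\<lambda>n. cmod (\<phi> n)) F + L2_set (\<lambda>n. cmod (\<psi> n)) F"
      by (rule L2_set_triangle_ineq)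
    finally show ?thesis
      using L2_set_le_l2norm[OF assms(1) F] L2_set_le_l2norm[OF assms(2) F] by linarith
  qed
  from l2_boundI[OF this] show "(\<lambda>n. \<phi> n + \<psi> n) \<in> l2"
    "l2norm (\<lambda>n. \<phi> n + \<psi> n) \<le> l2norm \<phi> + l2norm \<psi>" by auto
qed

lemma l2_mult_bounded:
  assumes "\<phi> \<in> l2" "\<And>n. cmod (c n) \<le> K"
  shows "(\<lambda>n. c n * \<phi> n) \<in> l2" "l2norm (\<lambda>n. c n * \<phi> n) \<le> K * l2norm \<phi>"
proof -
  have K: "0 \<le> K" using assms(2)[of 0] norm_ge_zero order_trans by blast
  have "L2_set (\<lambda>n. cmod (c n * \<phi> n)) F \<le> K * l2norm \<phi>" if F: "finite F" for F
  proof -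
    have "L2_set (\<lambda>n. cmod (c n * \<phi> n)) F \<le> L2_set (\<lambda>n. K * cmod (\<phi> n)) F"
      by (intro L2_set_mono) (auto simp: norm_mult intro!: mult_right_mono assms)
    also have "\<dots> = K * L2_set (\<lambda>n. cmod (\<phi> n)) F" by (simp add: L2_set_right_distrib K)
    finally show ?thesis
      using mult_left_mono[OF L2_set_le_l2norm[OF assms(1) F] K] by linarith
  qed
  from l2_boundI[OF this] show "(\<lambda>n. c n * \<phi> n) \<in> l2"
    "l2norm (\<lambda>n. c n * \<phi> n) \<le> K * l2norm \<phi>" by auto
qed

lemma l2_shift:
  assumes "\<phi> \<in> l2"
  shows "(\<lambda>n. \<phi> (n + d)) \<in> l2" "l2norm (\<lambda>n. \<phi> (n + d)) \<le> l2norm \<phi>"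
proof -
  have "L2_set (\<lambda>n. cmod (\<phi> (n + d))) F \<le> l2norm \<phi>" if F: "finite F" for F
  proof -
    have "L2_set (\<lambda>n. cmod (\<phi> (n + d))) F = L2_set (\<lambda>n. cmod (\<phi> n)) ((\<lambda>n. n + d) ` F)"
      unfolding L2_set_def by (subst sum.reindex) (auto simp: inj_on_def)
    then show ?thesis using L2_set_le_l2norm[OF assms, of "(\<lambda>n. n + d) ` F"] F by simp
  qed
  from l2_boundI[OF this] show "(\<lambda>n. \<phi> (n + d)) \<in> l2"
    "l2norm (\<lambda>n. \<phi> (n + d)) \<le> l2norm \<phi>" by auto
qed

lemma l2_diff:
  assumes "\<phi> \<in> l2" "\<psi> \<in> l2"
  shows "(\<lambda>n. \<phi> n - \<psi> n) \<in> l2"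
  using l2_add(1)[OF assms(1) l2_mult_bounded(1)[OF assms(2), of "\<lambda>_. -1" 1]] by simp

lemma l2_schrod:
  assumes "\<phi> \<in> l2" "\<And>n. \<bar>W n\<bar> \<le> B"
  shows "schrod W \<phi> \<in> l2" "l2norm (schrod W \<phi>) \<le> (2 + B) * l2norm \<phi>"
proof -
  note s = l2_shift[OF assms(1), of 1] l2_shift[OF assms(1), of "-1"]
    l2_mult_bounded[OF assms(1), of "\<lambda>n. complex_of_real (W n)" B]
  have 1: "(\<lambda>n. \<phi> (n + 1) + \<phi> (n + -1)) \<in> l2"
    "l2norm (\<lambda>n. \<phi> (n + 1) + \<phi> (n + -1)) \<le> 2 * l2norm \<phi>"
    using l2_add[OF s(1,3)] s(2,4) by auto
  have e: "schrod W \<phi> = (\<lambda>n. (\<phi> (n + 1) + \<phi> (n + -1)) + complex_of_real (W n) * \<phi> n)"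
    by (auto simp: schrod_def)
  show "schrod W \<phi> \<in> l2" unfolding e using l2_add(1)[OF 1(1) s(5)] assms by simp
  show "l2norm (schrod W \<phi>) \<le> (2 + B) * l2norm \<phi>" unfolding e
    using l2_add(2)[OF 1(1) s(5)] s(6) 1(2) assms by (simp add: algebra_simps)
qed

section \<open>Summability of quadratic expressions and invariance under shifts\<close>

lemma summable_on_cmod2: "\<phi> \<in> l2 \<Longrightarrow> (\<lambda>n. (cmod (\<phi> n))\<^sup>2) summable_on UNIV"
  by (simp add: l2_def)

text \<open>By the inequality of arithmetic and geometric means, the terms are dominated by the sum
  of the two squared moduli.\<close>

lemma summable_on_cnj_mult:
  assumes "\<phi> \<in> l2" "\<psi> \<in> l2"
  shows "(\<lambda>n. Re (cnj (\<phi> n) * \<psi> n)) summable_on UNIV"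
proof -
  have "(\<lambda>n. (cmod (\<phi> n))\<^sup>2 + (cmod (\<psi> n))\<^sup>2) summable_on UNIV"
    using assms by (intro summable_on_add summable_on_cmod2)
  then have "(\<lambda>n. norm ((cmod (\<phi> n))\<^sup>2 + (cmod (\<psi> n))\<^sup>2)) summable_on UNIV" by simp
  moreover have "norm (Re (cnj (\<phi> n) * \<psi> n)) \<le> norm ((cmod (\<phi> n))\<^sup>2 + (cmod (\<psi> n))\<^sup>2)" for n
  proof -
    have "\<bar>Re (cnj (\<phi> n) * \<psi> n)\<bar> \<le> cmod (\<phi> n) * cmod (\<psi> n)"
      using abs_Re_le_cmod[of "cnj (\<phi> n) * \<psi> n"] by (simp add: norm_mult)
    also have "\<dots> \<le> (cmod (\<phi> n))\<^sup>2 + (cmod (\<psi> n))\<^sup>2"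
      using sum_squares_bound[of "cmod (\<phi> n)" "cmod (\<psi> n)"]
        mult_nonneg_nonneg[OF norm_ge_zero norm_ge_zero, of "\<phi> n" "\<psi> n"]
      unfolding mult.assoc by linarith
    finally show ?thesis by simp
  qed
  ultimately show ?thesis
    by (rule abs_summable_summable[OF Infinite_Sum.abs_summable_on_comparison_test])
qed

lemma infsum_shift:
  fixes f :: "int \<Rightarrow> real"
  shows "(\<Sum>\<^sub>\<infinity>n. f (n + d)) = (\<Sum>\<^sub>\<infinity>n. f n)"
  by (rule infsum_reindex_bij_betw) (rule bij_betw_byWitness[where f'="\<lambda>n. n - d"]; auto)

lemma summable_on_shift:
  fixes f :: "int \<Rightarrow> real"
  assumes "f summable_on UNIV"
  shows "(\<lambda>n. f (n + d)) summable_on UNIV"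
proof -
  have "f summable_on range (\<lambda>n. n + d)" using assms by (simp add: surj_plus_right)
  then show ?thesis by (subst (asm) summable_on_reindex) (auto simp: inj_on_def o_def)
qed

section \<open>Completeness of the sequence space, fixed points and coercive operators\<close>

lemma l2_dist_triangle:
  assumes "\<phi> \<in> l2" "\<psi> \<in> l2" "\<eta> \<in> l2"
  shows "l2norm (\<lambda>n. \<phi> n - \<eta> n) \<le> l2norm (\<lambda>n. \<phi> n - \<psi> n) + l2norm (\<lambda>n. \<psi> n - \<eta> n)"
  using l2_add(2)[OF l2_diff[OF assms(1,2)] l2_diff[OF assms(2,3)]] by simp

lemma l2_dist_commute: "l2norm (\<lambda>n. \<phi> n - \<psi> n) = l2norm (\<lambda>n. \<psi> n - \<phi> n)"
  unfolding l2norm_def by (simp add: norm_minus_commute)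

text \<open>Banach's fixed point argument together with the completeness of \<open>l2\<close>: the
  iterates of zero converge in every coordinate, and their geometric error bounds on finite sets of
  coordinates survive the limit.\<close>

lemma l2_contraction_fixpoint:
  assumes F: "\<And>\<phi>. \<phi> \<in> l2 \<Longrightarrow> F \<phi> \<in> l2" and \<rho>: "0 \<le> \<rho>" "\<rho> < 1"
    and contr: "\<And>\<phi> \<psi>. \<phi> \<in> l2 \<Longrightarrow> \<psi> \<in> l2 \<Longrightarrow>
      l2norm (\<lambda>n. F \<phi> n - F \<psi> n) \<le> \<rho> * l2norm (\<lambda>n. \<phi> n - \<psi> n)"
  shows "\<exists>\<phi>\<in>l2. F \<phi> = \<phi>"
proof -
  define it where "it k = (F ^^ k) (\<lambda>_. 0)" for k
  define d where "d = l2norm (\<lambda>n. it 1 n - it 0 n)"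
  \<comment> \<open>The value of the geometric series with first term \<open>d\<close> and ratio
    \<open>\<rho>\<close>, equivalently the solution of \<open>D = \<rho> * D + d\<close>; this
    equation closes the induction for \<open>bd\<close>.\<close>
  define D where "D = d / (1 - \<rho>)"
  have it_Suc: "it (Suc k) = F (it k)" for k by (simp add: it_def)
  have itl2: "it k \<in> l2" for k
    by (induction k) (auto simp: it_Suc F, simp add: it_def l2norm_zero)
  have shift: "l2norm (\<lambda>n. it (k + j) n - it (k + i) n) \<le> \<rho> ^ k * l2norm (\<lambda>n. it j n - it i n)" for k i j
  proof (induction k)
    case (Suc k)
    have "l2norm (\<lambda>n. it (Suc k + j) n - it (Suc k + i) n) \<le> \<rho> * l2norm (\<lambda>n. it (k + j) n - it (k + i) n)"
      using contr[OF itl2 itl2] by (simp add: it_Suc)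
    also have "\<dots> \<le> \<rho> * (\<rho> ^ k * l2norm (\<lambda>n. it j n - it i n))" by (intro mult_left_mono Suc \<rho>)
    finally show ?case by (simp add: mult.assoc)
  qed simp
  have D0: "0 \<le> D" unfolding D_def d_def using \<rho> l2norm_nonneg by simp
  have bd: "l2norm (\<lambda>n. it j n - it 0 n) \<le> D" for j
  proof (induction j)
    case 0 then show ?case using D0 by (simp add: l2norm_zero)
  next
    case (Suc j)
    have "l2norm (\<lambda>n. it (Suc j) n - it 0 n) \<le> l2norm (\<lambda>n. it (Suc j) n - it 1 n) + d"
      unfolding d_def by (intro l2_dist_triangle itl2)
    also have "\<dots> \<le> \<rho> * l2norm (\<lambda>n. it j n - it 0 n) + d" using shift[of 1 j 0] by simp
    also have "\<dots> \<le> \<rho> * D + d" by (intro add_right_mono mult_left_mono Suc \<rho>)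
    also have "\<dots> = D" unfolding D_def using \<rho> by (simp add: field_simps)
    finally show ?case .
  qed
  have bk: "l2norm (\<lambda>n. it (k + j) n - it k n) \<le> \<rho> ^ k * D" for k j
    using order_trans[OF shift[of k j 0] mult_left_mono[OF bd]] \<rho> by simp
  have pow: "(\<lambda>k. \<rho> ^ k * c) \<longlonglongrightarrow> 0" for c
    by (rule tendsto_mult_left_zero[OF LIMSEQ_realpow_zero[OF \<rho>]])
  have "Cauchy (\<lambda>k. it k n)" for n
    unfolding Cauchy_altdef
  proof (intro allI impI)
    fix \<epsilon> :: real assume "\<epsilon> > 0"
    then obtain N where N: "\<rho> ^ k * D < \<epsilon>" if "k \<ge> N" for k
      using order_tendstoD(2)[OF pow] unfolding eventually_sequentially by blast
    have "dist (it m n) (it k n) < \<epsilon>" if "m \<ge> N" "k > m" for m k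
    proof -
      have "cmod (it k n - it m n) \<le> l2norm (\<lambda>n. it k n - it m n)"
        by (rule cmod_le_l2norm[OF l2_diff[OF itl2 itl2]])
      also have "\<dots> \<le> \<rho> ^ m * D" using bk[of m "k - m"] that by simp
      finally show ?thesis using N[OF that(1)] by (simp add: dist_norm norm_minus_commute)
    qed
    then show "\<exists>N. \<forall>m\<ge>N. \<forall>k>m. dist (it m n) (it k n) < \<epsilon>" by blast
  qed
  then have "\<forall>n. \<exists>l. (\<lambda>k. it k n) \<longlonglongrightarrow> l" using Cauchy_convergent convergent_def by blast
  then obtain \<phi> where \<phi>: "\<And>n. (\<lambda>k. it k n) \<longlonglongrightarrow> \<phi> n" by metis
  \<comment> \<open>On a finite set \<open>S\<close> the norm depends continuously on finitely many
    coordinates, so letting \<open>j\<close> tend to infinity in \<open>bk\<close> keeps the bound.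
    Since it is uniform in \<open>S\<close>, the pointwise limit is also a limit in norm.\<close>
  have lim: "(\<lambda>n. \<phi> n - it k n) \<in> l2" "l2norm (\<lambda>n. \<phi> n - it k n) \<le> \<rho> ^ k * D" for k
  proof -
    have "L2_set (\<lambda>n. cmod (\<phi> n - it k n)) S \<le> \<rho> ^ k * D" if S: "finite S" for S
    proof (rule tendsto_upperbound)
      show "(\<lambda>j. L2_set (\<lambda>n. cmod (it (k + j) n - it k n)) S) \<longlonglongrightarrow> L2_set (\<lambda>n. cmod (\<phi> n - it k n)) S"
        unfolding L2_set_def
        by (intro tendsto_intros) (subst add.commute, rule LIMSEQ_ignore_initial_segment[OF \<phi>])
      show "\<forall>\<^sub>F j in sequentially. L2_set (\<lambda>n. cmod (it (k + j) n - it k n)) S \<le> \<rho> ^ k * D"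
        using order_trans[OF L2_set_le_l2norm[OF l2_diff[OF itl2 itl2] S] bk] by simp
    qed simp
    from l2_boundI[OF this] show "(\<lambda>n. \<phi> n - it k n) \<in> l2"
      "l2norm (\<lambda>n. \<phi> n - it k n) \<le> \<rho> ^ k * D" by auto
  qed
  have \<phi>l2: "\<phi> \<in> l2" using l2_add(1)[OF lim(1)[of 0] itl2[of 0]] by simp
  \<comment> \<open>Comparing both sequences with the iterate \<open>it (Suc k)\<close> gives two
    errors, each at most \<open>\<rho> ^ k * D\<close>. The left side does not depend on
    \<open>k\<close>, so it must vanish.\<close>
  have "l2norm (\<lambda>n. F \<phi> n - \<phi> n) \<le> \<rho> ^ k * (2 * D)" for k
  proof -
    have "l2norm (\<lambda>n. F \<phi> n - \<phi> n) \<le> l2norm (\<lambda>n. F \<phi> n - it (Suc k) n) + l2norm (\<lambda>n. it (Suc k) n - \<phi> n)"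
      by (intro l2_dist_triangle itl2 F \<phi>l2)
    also have "l2norm (\<lambda>n. F \<phi> n - it (Suc k) n) \<le> \<rho> * l2norm (\<lambda>n. \<phi> n - it k n)"
      unfolding it_Suc by (intro contr itl2 \<phi>l2)
    also have "\<dots> \<le> \<rho> * (\<rho> ^ k * D)" by (intro mult_left_mono lim \<rho>)
    also have "\<dots> \<le> 1 * (\<rho> ^ k * D)" using \<rho> D0 by (intro mult_right_mono) auto
    also have "l2norm (\<lambda>n. it (Suc k) n - \<phi> n) \<le> \<rho> ^ Suc k * D"
      using lim(2)[of "Suc k"] by (simp add: l2_dist_commute)
    also have "\<dots> \<le> 1 * (\<rho> ^ k * D)" unfolding power_Suc mult.assoc using \<rho> D0 by (intro mult_right_mono) auto
    finally show ?thesis by (simp add: mult_ac)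
  qed
  then have "l2norm (\<lambda>n. F \<phi> n - \<phi> n) \<le> 0"
    by (intro tendsto_lowerbound[OF pow[of "2 * D"]]) auto
  from l2norm_eq_0D[OF l2_diff[OF F[OF \<phi>l2] \<phi>l2] this] have "F \<phi> = \<phi>"
    by (simp add: fun_eq_iff)
  with \<phi>l2 show ?thesis by blast
qed

text \<open>For a small step \<open>t\<close>, coercivity makes
  \<open>\<phi> - t * (T \<phi> - \<psi>)\<close> a contraction in \<open>\<phi>\<close>, whose
  fixed point solves \<open>T \<phi> = \<psi>\<close>. Coercivity also bounds \<open>T\<close> from
  below, which gives uniqueness and the bound on the inverse.\<close>

lemma l2_lax_milgram:
  assumes T: "\<And>\<phi>. \<phi> \<in> l2 \<Longrightarrow> T \<phi> \<in> l2"
    and bounded: "\<And>\<phi>. \<phi> \<in> l2 \<Longrightarrow> l2norm (T \<phi>) \<le> K * l2norm \<phi>"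
    and diff: "\<And>\<phi> \<psi>. \<phi> \<in> l2 \<Longrightarrow> \<psi> \<in> l2 \<Longrightarrow> T (\<lambda>n. \<phi> n - \<psi> n) = (\<lambda>n. T \<phi> n - T \<psi> n)"
    and c: "0 < c"
    and coercive: "\<And>\<phi>. \<phi> \<in> l2 \<Longrightarrow> c * (l2norm \<phi>)\<^sup>2 \<le> (\<Sum>\<^sub>\<infinity>n. Re (cnj (\<phi> n) * T \<phi> n))"
  shows "has_bounded_inverse_l2 T"
proof -
  \<comment> \<open>This expansion serves twice: with \<open>t = 1 / c\<close> for the lower bound
    and with \<open>t = c / k\<^sup>2\<close> for the contraction.\<close>
  have expand: "(l2norm (\<lambda>n. \<phi> n - complex_of_real t * T \<phi> n))\<^sup>2
      = (l2norm \<phi>)\<^sup>2 - 2 * t * (\<Sum>\<^sub>\<infinity>n. Re (cnj (\<phi> n) * T \<phi> n)) + t\<^sup>2 * (l2norm (T \<phi>))\<^sup>2"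
    if \<phi>: "\<phi> \<in> l2" for t \<phi>
  proof -
    have "(cmod (\<phi> n - complex_of_real t * T \<phi> n))\<^sup>2
      = (cmod (\<phi> n))\<^sup>2 + ((- 2 * t) * Re (cnj (\<phi> n) * T \<phi> n) + t\<^sup>2 * (cmod (T \<phi> n))\<^sup>2)" for n
      unfolding cmod_power2 by (simp add: power2_eq_square algebra_simps)
    then show ?thesis unfolding l2norm_power2
      by (simp only: infsum_add infsum_cmult_right' summable_on_cmod2 summable_on_cnj_mult
          summable_on_add summable_on_cmult_right T \<phi>)
  qed
  \<comment> \<open>The square of a norm is nonnegative; at \<open>t = 1 / c\<close> the coercive
    term outweighs the leading term and leaves minus the squared norm of \<open>\<phi>\<close>. This
    replaces an appeal to the Cauchy-Schwarz inequality.\<close>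
  have lower: "l2norm \<phi> \<le> (1 / c) * l2norm (T \<phi>)" if \<phi>: "\<phi> \<in> l2" for \<phi>
  proof -
    have "0 \<le> (l2norm (\<lambda>n. \<phi> n - complex_of_real (1 / c) * T \<phi> n))\<^sup>2" by simp
    also have "\<dots> \<le> (l2norm \<phi>)\<^sup>2 - 2 * (1 / c) * (c * (l2norm \<phi>)\<^sup>2) + (1 / c)\<^sup>2 * (l2norm (T \<phi>))\<^sup>2"
      unfolding expand[OF \<phi>] using coercive[OF \<phi>] c
      by (intro add_right_mono diff_left_mono mult_left_mono) auto
    also have "\<dots> = ((1 / c) * l2norm (T \<phi>))\<^sup>2 - (l2norm \<phi>)\<^sup>2"
      using c by (simp add: field_simps power2_eq_square)
    finally show ?thesis
      using c l2norm_nonneg by (intro power2_le_imp_le[of "l2norm \<phi>"]) auto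
  qed
  \<comment> \<open>Enlarging \<open>K\<close> to \<open>k\<close> ensures
    \<open>0 < c \<le> k\<close>, so that \<open>\<rho>\<close> is a real number below 1. The step
    \<open>t = c / k\<^sup>2\<close> minimizes \<open>1 - 2 * t * c + t\<^sup>2 * k\<^sup>2\<close>,
    and the minimum is the square of \<open>\<rho>\<close>.\<close>
  define k where "k = max K c"
  define t where "t = c / k\<^sup>2"
  define \<rho> where "\<rho> = sqrt (1 - c\<^sup>2 / k\<^sup>2)"
  have k: "0 < k" "c \<le> k" "K \<le> k" using c by (auto simp: k_def)
  have ck: "c\<^sup>2 \<le> k\<^sup>2" using k c by (intro power_mono) auto
  have \<rho>: "0 \<le> \<rho>" "\<rho> < 1" "\<rho>\<^sup>2 = 1 - c\<^sup>2 / k\<^sup>2"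
    using k c ck by (auto simp: \<rho>_def)
  have solve: "\<exists>\<phi>\<in>l2. T \<phi> = \<psi>" if \<psi>: "\<psi> \<in> l2" for \<psi>
  proof -
    define F where "F \<phi> = (\<lambda>n. \<phi> n - complex_of_real t * (T \<phi> n - \<psi> n))" for \<phi>
    have "\<exists>\<phi>\<in>l2. F \<phi> = \<phi>"
    proof (rule l2_contraction_fixpoint[OF _ \<rho>(1,2)])
      show "F \<phi> \<in> l2" if "\<phi> \<in> l2" for \<phi>
        unfolding F_def
        by (rule l2_diff[OF that l2_mult_bounded(1)[OF l2_diff[OF T[OF that] \<psi>], where K="\<bar>t\<bar>"]]) simp
      fix \<phi> \<phi>' assume ph: "\<phi> \<in> l2" "\<phi>' \<in> l2"
      define v where "v = (\<lambda>n. \<phi> n - \<phi>' n)"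
      have v: "v \<in> l2" unfolding v_def by (rule l2_diff[OF ph])
      have "F \<phi> n - F \<phi>' n = v n - complex_of_real t * T v n" for n
        unfolding F_def v_def diff[OF ph] by (simp add: algebra_simps)
      then have "(l2norm (\<lambda>n. F \<phi> n - F \<phi>' n))\<^sup>2 = (l2norm (\<lambda>n. v n - complex_of_real t * T v n))\<^sup>2"
        by simp
      also have "\<dots> \<le> (l2norm v)\<^sup>2 - 2 * t * (c * (l2norm v)\<^sup>2) + t\<^sup>2 * (k * l2norm v)\<^sup>2"
        unfolding expand[OF v]
      proof (rule add_mono)
        have "2 * t * (c * (l2norm v)\<^sup>2) \<le> 2 * t * (\<Sum>\<^sub>\<infinity>n. Re (cnj (v n) * T v n))"
          using c by (intro mult_left_mono[OF coercive[OF v]]) (simp add: t_def)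
        then show "(l2norm v)\<^sup>2 - 2 * t * (\<Sum>\<^sub>\<infinity>n. Re (cnj (v n) * T v n))
          \<le> (l2norm v)\<^sup>2 - 2 * t * (c * (l2norm v)\<^sup>2)" by (rule diff_left_mono)
        have "l2norm (T v) \<le> k * l2norm v"
          using bounded[OF v] mult_right_mono[OF k(3) l2norm_nonneg[of v]] by linarith
        from power_mono[OF this l2norm_nonneg]
        show "t\<^sup>2 * (l2norm (T v))\<^sup>2 \<le> t\<^sup>2 * (k * l2norm v)\<^sup>2" by (rule mult_left_mono) simp
      qed
      also have "\<dots> = (\<rho> * l2norm v)\<^sup>2"
        unfolding power_mult_distrib \<rho>(3) t_def using k by (simp add: field_simps power2_eq_square)
      finally show "l2norm (\<lambda>n. F \<phi> n - F \<phi>' n) \<le> \<rho> * l2norm (\<lambda>n. \<phi> n - \<phi>' n)"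
        unfolding v_def[symmetric]
        by (rule power2_le_imp_le) (intro mult_nonneg_nonneg \<rho>(1) l2norm_nonneg)
    qed
    then obtain \<phi> where \<phi>: "\<phi> \<in> l2" "F \<phi> = \<phi>" by blast
    have "t \<noteq> 0" using c k by (simp add: t_def)
    then have "T \<phi> n = \<psi> n" for n using fun_cong[OF \<phi>(2), of n] by (simp add: F_def)
    then show ?thesis using \<phi>(1) by blast
  qed
  define G where "G \<psi> = (SOME \<phi>. \<phi> \<in> l2 \<and> T \<phi> = \<psi>)" for \<psi>
  have G: "G \<psi> \<in> l2" "T (G \<psi>) = \<psi>" if "\<psi> \<in> l2" for \<psi>
    using someI_ex[of "\<lambda>\<phi>. \<phi> \<in> l2 \<and> T \<phi> = \<psi>"] solve[OF that] unfolding G_def by blast+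
  have GT: "G (T \<phi>) = \<phi>" if \<phi>: "\<phi> \<in> l2" for \<phi>
  proof -
    note g = G[OF T[OF \<phi>]]
    have "T (\<lambda>n. G (T \<phi>) n - \<phi> n) = (\<lambda>_. 0)" using diff[OF g(1) \<phi>] g(2) by simp
    then have "l2norm (\<lambda>n. G (T \<phi>) n - \<phi> n) \<le> 0"
      using lower[OF l2_diff[OF g(1) \<phi>]] l2norm_zero by simp
    from l2norm_eq_0D[OF l2_diff[OF g(1) \<phi>] this] show ?thesis by (simp add: fun_eq_iff)
  qed
  have "l2norm (G \<psi>) \<le> (1 / c) * l2norm \<psi>" if "\<psi> \<in> l2" for \<psi>
    using lower[OF G(1)[OF that]] G(2)[OF that] by simp
  with G GT show ?thesis unfolding has_bounded_inverse_l2_def by blast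
qed

subsection \<open>Invertibility in the gaps\<close>

text \<open>Here \<open>w\<close> and \<open>v\<close> are the diagonal entries at the ends of an
  edge, \<open>x\<close> and \<open>y\<close> the moduli of the wave there, and \<open>e\<close> the
  real part of the hopping term. Opposite signs cancel; otherwise
  \<open>2 \<le> \<theta> * sqrt \<bar>w * v\<bar>\<close>, and the inequality of arithmetic and
  geometric means with weights \<open>\<bar>w\<bar>\<close>, \<open>\<bar>v\<bar>\<close>
  applies.\<close>

lemma sgn_edge_bound:
  fixes w v :: real
  assumes "w * v < 0 \<or> 4 \<le> \<theta>\<^sup>2 * (w * v)" "0 \<le> \<theta>" "\<bar>e\<bar> \<le> x * y" "0 \<le> x" "0 \<le> y"
  shows "2 * \<bar>(sgn w + sgn v) * e\<bar> \<le> \<theta> * (\<bar>w\<bar> * x\<^sup>2 + \<bar>v\<bar> * y\<^sup>2)"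
proof (cases "w * v < 0")
  case True
  then have "sgn w + sgn v = 0" by (auto simp: mult_less_0_iff)
  then show ?thesis using assms by simp
next
  case False
  have wv: "4 \<le> \<theta>\<^sup>2 * \<bar>w\<bar> * \<bar>v\<bar>" using assms(1) False by (simp add: abs_mult[symmetric] mult.assoc)
  have r: "2 \<le> \<theta> * (sqrt \<bar>w\<bar> * sqrt \<bar>v\<bar>)"
  proof (rule power2_le_imp_le)
    show "2\<^sup>2 \<le> (\<theta> * (sqrt \<bar>w\<bar> * sqrt \<bar>v\<bar>))\<^sup>2" using wv by (simp add: power_mult_distrib)
  qed (use assms in auto)
  have "\<bar>(sgn w + sgn v) * e\<bar> \<le> 2 * (x * y)"
    unfolding abs_mult by (rule mult_mono) (use assms in \<open>auto simp: sgn_if\<close>)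
  also have "\<dots> \<le> \<theta> * (sqrt \<bar>w\<bar> * sqrt \<bar>v\<bar>) * (x * y)"
    using r assms by (intro mult_right_mono) auto
  also have "\<dots> * 2 = \<theta> * (2 * (sqrt \<bar>w\<bar> * x) * (sqrt \<bar>v\<bar> * y))" by (simp add: algebra_simps)
  also have "\<dots> \<le> \<theta> * ((sqrt \<bar>w\<bar> * x)\<^sup>2 + (sqrt \<bar>v\<bar> * y)\<^sup>2)"
    by (intro mult_left_mono sum_squares_bound assms)
  finally show ?thesis by (simp add: power_mult_distrib)
qed

text \<open>The hopping terms are regrouped by edges, where \<open>sgn_edge_bound\<close> controls
  them by the diagonal terms at both ends. Every site lies on two edges and each edge costs the
  fraction \<open>\<theta> / 2\<close>, so a fraction \<open>1 - \<theta>\<close> of the diagonal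
  survives.\<close>

lemma schrod_coercive:
  assumes \<phi>: "\<phi> \<in> l2" and B: "\<And>n. \<bar>W n\<bar> \<le> B" and \<theta>: "0 \<le> \<theta>"
    and edge: "\<And>n. W n * W (n + 1) < 0 \<or> 4 \<le> \<theta>\<^sup>2 * (W n * W (n + 1))"
  shows "(1 - \<theta>) * (\<Sum>\<^sub>\<infinity>n. \<bar>W n\<bar> * (cmod (\<phi> n))\<^sup>2)
    \<le> (\<Sum>\<^sub>\<infinity>n. Re (cnj (\<phi> n) * (complex_of_real (sgn (W n)) * schrod W \<phi> n)))"
proof -
  define u where "u n = \<bar>W n\<bar> * (cmod (\<phi> n))\<^sup>2" for n
  define e where "e n = Re (cnj (\<phi> n) * \<phi> (n + 1))" for n
  \<comment> \<open>Both \<open>g n\<close> and \<open>f n\<close> belong to the edge between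
    \<open>n\<close> and \<open>n + 1\<close>: \<open>g n\<close> arises in row \<open>n\<close> of
    the form, \<open>f n\<close> in row \<open>n + 1\<close>. Hence \<open>f\<close> enters the form
    shifted by one, and \<open>infsum_shift\<close> moves it back.\<close>
  define g where "g n = sgn (W n) * e n" for n
  define f where "f n = sgn (W (n + 1)) * e n" for n
  have sg: "\<bar>sgn (w::real)\<bar> \<le> 1" for w by (simp add: sgn_if)
  have W\<phi>: "(\<lambda>n. complex_of_real \<bar>W n\<bar> * \<phi> n) \<in> l2"
    by (rule l2_mult_bounded[OF \<phi>, where K=B]) (use B in simp)
  have "u = (\<lambda>n. Re (cnj (\<phi> n) * (complex_of_real \<bar>W n\<bar> * \<phi> n)))"
    unfolding u_def fun_eq_iff unfolding cmod_power2 by (simp add: algebra_simps power2_eq_square)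
  then have su: "u summable_on UNIV" using summable_on_cnj_mult[OF \<phi> W\<phi>] by simp
  have "(\<lambda>n. complex_of_real (sgn (W n)) * \<phi> (n + 1)) \<in> l2"
    by (rule l2_mult_bounded[OF l2_shift(1)[OF \<phi>], where K=1]) (use sg in simp)
  from summable_on_cnj_mult[OF \<phi> this] have sg': "g summable_on UNIV"
    unfolding g_def e_def by (simp add: algebra_simps)
  have "(\<lambda>n. complex_of_real (sgn (W (n + 1))) * \<phi> (n + 1)) \<in> l2"
    by (rule l2_mult_bounded[OF l2_shift(1)[OF \<phi>], where K=1]) (use sg in simp)
  from summable_on_cnj_mult[OF \<phi> this] have sf: "f summable_on UNIV"
    unfolding f_def e_def by (simp add: algebra_simps)
  have sf': "(\<lambda>n. f (n + -1)) summable_on UNIV" by (rule summable_on_shift[OF sf])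
  have su': "(\<lambda>n. u (n + 1)) summable_on UNIV" by (rule summable_on_shift[OF su])
  have pt: "Re (cnj (\<phi> n) * (complex_of_real (sgn (W n)) * schrod W \<phi> n)) = u n + (g n + f (n + -1))" for n
    unfolding u_def g_def f_def e_def schrod_def
    unfolding cmod_power2 by (simp add: abs_sgn algebra_simps power2_eq_square)
  have "(\<Sum>\<^sub>\<infinity>n. Re (cnj (\<phi> n) * (complex_of_real (sgn (W n)) * schrod W \<phi> n)))
      = infsum u UNIV + (infsum g UNIV + (\<Sum>\<^sub>\<infinity>n. f (n + -1)))"
    unfolding pt by (simp add: infsum_add su sg' sf' summable_on_add del: add_uminus_conv_diff)
  also have "(\<Sum>\<^sub>\<infinity>n. f (n + -1)) = infsum f UNIV" by (rule infsum_shift)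
  also have "infsum g UNIV + infsum f UNIV = (\<Sum>\<^sub>\<infinity>n. g n + f n)" by (rule infsum_add[OF sg' sf, symmetric])
  finally have E: "(\<Sum>\<^sub>\<infinity>n. Re (cnj (\<phi> n) * (complex_of_real (sgn (W n)) * schrod W \<phi> n)))
      = infsum u UNIV + (\<Sum>\<^sub>\<infinity>n. g n + f n)" .
  have su2: "(\<lambda>n. (- \<theta> / 2) * (u n + u (n + 1))) summable_on UNIV"
    by (intro summable_on_cmult_right summable_on_add su su')
  have "- \<theta> * infsum u UNIV = (- \<theta> / 2) * (infsum u UNIV + (\<Sum>\<^sub>\<infinity>n. u (n + 1)))"
    by (simp add: infsum_shift)
  also have "\<dots> = (\<Sum>\<^sub>\<infinity>n. (- \<theta> / 2) * (u n + u (n + 1)))"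
    by (simp only: infsum_cmult_right' infsum_add[OF su su'])
  also have "\<dots> \<le> (\<Sum>\<^sub>\<infinity>n. g n + f n)"
  proof (rule infsum_mono[OF su2 summable_on_add[OF sg' sf]])
    fix n
    have "\<bar>e n\<bar> \<le> cmod (\<phi> n) * cmod (\<phi> (n + 1))"
      unfolding e_def using abs_Re_le_cmod[of "cnj (\<phi> n) * \<phi> (n + 1)"] by (simp add: norm_mult)
    from sgn_edge_bound[OF edge[of n] \<theta> this]
    have "2 * \<bar>g n + f n\<bar> \<le> \<theta> * (u n + u (n + 1))"
      unfolding g_def f_def u_def by (simp add: algebra_simps)
    moreover have "- (x / 2) \<le> y" if "2 * \<bar>y\<bar> \<le> x" for x y :: real using that by linarith
    ultimately have "- (\<theta> * (u n + u (n + 1)) / 2) \<le> g n + f n" by blast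
    then show "(- \<theta> / 2) * (u n + u (n + 1)) \<le> g n + f n" by simp
  qed
  finally show ?thesis unfolding E u_def by (simp add: algebra_simps)
qed

text \<open>Each single strict inequality \<open>4 < p\<close> survives multiplication by
  \<open>\<theta>\<^sup>2\<close> for \<open>\<theta>\<close> close to 1; finitely many of them
  share a common \<open>\<theta>\<close>. This turns the pointwise gap condition into a uniform
  one.\<close>

lemma finite_uniform_gap_margin:
  fixes P :: "real set"
  assumes "finite P" "\<And>p. p \<in> P \<Longrightarrow> p \<notin> {0..4}"
  obtains \<theta> where "0 \<le> \<theta>" "\<theta> < 1" "\<And>p. p \<in> P \<Longrightarrow> p < 0 \<or> 4 \<le> \<theta>\<^sup>2 * p"
proof -
  have "\<forall>\<^sub>F \<theta> in at_left 1. p < 0 \<or> 4 \<le> \<theta>\<^sup>2 * p" if "p \<in> P" for p :: real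
  proof (cases "p < 0")
    case False
    then have "4 < 1\<^sup>2 * p" using assms(2)[OF that] by auto
    moreover have "((\<lambda>\<theta>. \<theta>\<^sup>2 * p) \<longlongrightarrow> 1\<^sup>2 * p) (at_left 1)" by (intro tendsto_intros)
    ultimately have "\<forall>\<^sub>F \<theta> in at_left 1. 4 < \<theta>\<^sup>2 * p" by (rule order_tendstoD(1)[rotated])
    then show ?thesis by (rule eventually_mono) simp
  qed simp
  then have "\<forall>\<^sub>F \<theta> in at_left 1. \<forall>p\<in>P. p < 0 \<or> 4 \<le> \<theta>\<^sup>2 * p"
    using assms(1) by (simp add: eventually_ball_finite_distrib)
  moreover have "\<forall>\<^sub>F \<theta>::real in at_left 1. \<theta> \<in> {0<..<1}" by (rule eventually_at_left_real) simp
  ultimately have "\<forall>\<^sub>F \<theta> in at_left 1. (\<forall>p\<in>P. p < 0 \<or> 4 \<le> \<theta>\<^sup>2 * p) \<and> \<theta> \<in> {0<..<1}"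
    by (rule eventually_conj)
  then obtain \<theta> :: real where "\<forall>p\<in>P. p < 0 \<or> 4 \<le> \<theta>\<^sup>2 * p" "\<theta> \<in> {0<..<1}"
    using eventually_happens'[OF trivial_limit_at_left_real] by blast
  then show thesis by (intro that[of \<theta>]) auto
qed

text \<open>The product of the operator with the sign of \<open>W\<close> is coercive, hence
  invertible. The sign is its own inverse, so it can be undone by applying it to the right-hand side
  first.\<close>

lemma schrod_has_bounded_inverse:
  assumes fin: "finite (range W)" and gap: "\<And>n. W n * W (n + 1) \<notin> {0..4}"
  shows "has_bounded_inverse_l2 (schrod W)"
proof -
  define s where "s n = complex_of_real (sgn (W n))" for n
  define T where "T \<phi> = (\<lambda>n. s n * schrod W \<phi> n)" for \<phi>
  define B where "B = Max (abs ` range W)"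
  \<comment> \<open>Positive because \<open>W\<close> takes finitely many values, none of them 0: a
    zero would put a product of neighbours into \<open>{0..4}\<close>. It converts the weighted sum
    in \<open>schrod_coercive\<close> into a multiple of the squared norm.\<close>
  define \<delta> where "\<delta> = Min (abs ` range W)"
  have W0: "W n \<noteq> 0" for n using gap[of n] by auto
  have B: "\<bar>W n\<bar> \<le> B" for n unfolding B_def using fin by (intro Max_ge) auto
  have \<delta>: "\<delta> \<le> \<bar>W n\<bar>" for n unfolding \<delta>_def using fin by (intro Min_le) auto
  have \<delta>0: "0 < \<delta>" unfolding \<delta>_def using fin W0 by (subst Min_gr_iff) auto
  have ss: "s n * s n = 1" for n using W0[of n] by (simp add: s_def sgn_if)
  have s1: "cmod (s n) \<le> 1" for n by (simp add: s_def sgn_if)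
  have "finite ((\<lambda>(x, y). x * y) ` (range W \<times> range W))" using fin by simp
  then have "finite (range (\<lambda>n. W n * W (n + 1)))" by (rule rev_finite_subset) auto
  then obtain \<theta> where \<theta>: "0 \<le> \<theta>" "\<theta> < 1" "\<And>n. W n * W (n + 1) < 0 \<or> 4 \<le> \<theta>\<^sup>2 * (W n * W (n + 1))"
    by (rule finite_uniform_gap_margin) (use gap in auto)
  have "has_bounded_inverse_l2 T"
  proof (rule l2_lax_milgram)
    fix \<phi> assume \<phi>: "\<phi> \<in> l2"
    note H = l2_schrod[OF \<phi>, of W B, OF B]
    show "T \<phi> \<in> l2" unfolding T_def by (rule l2_mult_bounded[OF H(1) s1])
    show "l2norm (T \<phi>) \<le> (2 + B) * l2norm \<phi>" unfolding T_def
      using l2_mult_bounded(2)[OF H(1), of s 1, OF s1] H(2) by simp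
    have sW: "(\<lambda>n. \<bar>W n\<bar> * (cmod (\<phi> n))\<^sup>2) summable_on UNIV"
    proof -
      have "(\<lambda>n. complex_of_real (sqrt \<bar>W n\<bar>) * \<phi> n) \<in> l2"
        by (rule l2_mult_bounded[OF \<phi>, where K="sqrt B"]) (use B in simp)
      from summable_on_cmod2[OF this] show ?thesis by (simp add: norm_mult power_mult_distrib)
    qed
    have "\<delta> * (l2norm \<phi>)\<^sup>2 \<le> (\<Sum>\<^sub>\<infinity>n. \<bar>W n\<bar> * (cmod (\<phi> n))\<^sup>2)"
      unfolding l2norm_power2 infsum_cmult_right'[symmetric]
      by (intro infsum_mono summable_on_cmult_right summable_on_cmod2 \<phi> sW mult_right_mono \<delta>) auto
    then have "(1 - \<theta>) * (\<delta> * (l2norm \<phi>)\<^sup>2) \<le> (1 - \<theta>) * (\<Sum>\<^sub>\<infinity>n. \<bar>W n\<bar> * (cmod (\<phi> n))\<^sup>2)"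
      using \<theta> by (intro mult_left_mono) auto
    also have "\<dots> \<le> (\<Sum>\<^sub>\<infinity>n. Re (cnj (\<phi> n) * T \<phi> n))"
      unfolding T_def s_def by (rule schrod_coercive[OF \<phi>, of W B \<theta>, OF B \<theta>(1,3)])
    finally show "((1 - \<theta>) * \<delta>) * (l2norm \<phi>)\<^sup>2 \<le> (\<Sum>\<^sub>\<infinity>n. Re (cnj (\<phi> n) * T \<phi> n))" by simp
  next
    show "T (\<lambda>n. \<phi> n - \<psi> n) = (\<lambda>n. T \<phi> n - T \<psi> n)" for \<phi> \<psi>
      by (auto simp: T_def schrod_def algebra_simps)
  qed (use \<theta> \<delta>0 in auto)
  then obtain G C where G: "\<And>\<psi>. \<psi> \<in> l2 \<Longrightarrow> G \<psi> \<in> l2" "\<And>\<psi>. \<psi> \<in> l2 \<Longrightarrow> l2norm (G \<psi>) \<le> C * l2norm \<psi>"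
    "\<And>\<phi>. \<phi> \<in> l2 \<Longrightarrow> G (T \<phi>) = \<phi>" "\<And>\<psi>. \<psi> \<in> l2 \<Longrightarrow> T (G \<psi>) = \<psi>"
    unfolding has_bounded_inverse_l2_def by blast
  have s_s: "s n * (s n * z) = z" for n z by (simp add: mult.assoc[symmetric] ss)
  have s\<psi>: "(\<lambda>n. s n * \<psi> n) \<in> l2" "l2norm (\<lambda>n. s n * \<psi> n) \<le> l2norm \<psi>" if "\<psi> \<in> l2" for \<psi>
    using l2_mult_bounded[OF that, of s 1, OF s1] by auto
  \<comment> \<open>The constant \<open>\<bar>C\<bar>\<close> replaces \<open>C\<close>, whose sign
    is unknown, since the norm of \<open>s * \<psi>\<close> is only estimated from above.\<close>
  show ?thesis unfolding has_bounded_inverse_l2_def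
  proof (intro exI[of _ "\<lambda>\<psi>. G (\<lambda>n. s n * \<psi> n)"] exI[of _ "\<bar>C\<bar>"] conjI ballI)
    fix \<psi> assume \<psi>: "\<psi> \<in> l2"
    show "G (\<lambda>n. s n * \<psi> n) \<in> l2" by (rule G(1)[OF s\<psi>(1)[OF \<psi>]])
    have "l2norm (G (\<lambda>n. s n * \<psi> n)) \<le> C * l2norm (\<lambda>n. s n * \<psi> n)" by (rule G(2)[OF s\<psi>(1)[OF \<psi>]])
    also have "\<dots> \<le> \<bar>C\<bar> * l2norm \<psi>" by (intro mult_mono s\<psi>(2) \<psi> l2norm_nonneg) auto
    finally show "l2norm (G (\<lambda>n. s n * \<psi> n)) \<le> \<bar>C\<bar> * l2norm \<psi>" .
    show "G (\<lambda>n. s n * schrod W \<psi> n) = \<psi>" using G(3)[OF \<psi>] by (simp add: T_def)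
    have "s n * (s n * schrod W (G (\<lambda>n. s n * \<psi> n)) n) = s n * (s n * \<psi> n)" for n
      using fun_cong[OF G(4)[OF s\<psi>(1)[OF \<psi>]], of n] by (simp add: T_def)
    then show "schrod W (G (\<lambda>n. s n * \<psi> n)) = \<psi>" unfolding s_s by (simp add: fun_eq_iff)
  qed
qed

subsection \<open>Truncated Bloch waves\<close>

lemma l2_finite_support:
  assumes "finite S" "\<And>n. n \<notin> S \<Longrightarrow> \<phi> n = 0"
  shows "\<phi> \<in> l2" "(l2norm \<phi>)\<^sup>2 = (\<Sum>n\<in>S. (cmod (\<phi> n))\<^sup>2)"
proof -
  have "(\<lambda>n. (cmod (\<phi> n))\<^sup>2) summable_on UNIV \<longleftrightarrow> (\<lambda>n. (cmod (\<phi> n))\<^sup>2) summable_on S"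
    by (rule summable_on_cong_neutral) (use assms in auto)
  then show "\<phi> \<in> l2" using assms(1) by (simp add: l2_def)
  have "(\<Sum>\<^sub>\<infinity>n. (cmod (\<phi> n))\<^sup>2) = (\<Sum>\<^sub>\<infinity>n\<in>S. (cmod (\<phi> n))\<^sup>2)"
    by (rule infsum_cong_neutral) (use assms in auto)
  then show "(l2norm \<phi>)\<^sup>2 = (\<Sum>n\<in>S. (cmod (\<phi> n))\<^sup>2)" using assms(1) by (simp add: l2norm_power2)
qed

text \<open>The ansatz of amplitudes \<open>\<alpha>\<close>, \<open>\<beta>\<close> on even and odd
  sites times a plane wave of frequency \<open>\<kappa>\<close> leads to a two by two system with
  determinant \<open>p * q - c\<^sup>2\<close>, where \<open>c = 2 * cos \<kappa>\<close>. The
  hypothesis is what allows a real \<open>\<kappa>\<close> with vanishing determinant.\<close>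

lemma two_periodic_bloch_wave:
  fixes p q :: real
  assumes "p * q \<in> {0..4}"
  obtains \<alpha> \<beta> :: real and f :: "int \<Rightarrow> complex"
  where "\<alpha> \<noteq> 0 \<or> \<beta> \<noteq> 0" "\<And>j. cmod (f j) = (if even j then \<bar>\<alpha>\<bar> else \<bar>\<beta>\<bar>)"
    "\<And>j. schrod (\<lambda>j. if even j then p else q) f j = 0"
proof -
  define \<kappa> where "\<kappa> = arccos (sqrt (p * q) / 2)"
  define c where "c = 2 * cos \<kappa>"
  have "sqrt (p * q) \<le> 2" using assms by (intro real_le_lsqrt) auto
  moreover have "0 \<le> sqrt (p * q)" using assms by simp
  ultimately have "cos \<kappa> = sqrt (p * q) / 2"
    unfolding \<kappa>_def by (intro cos_arccos) linarith+
  then have "c = sqrt (p * q)" by (simp add: c_def)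
  then have c: "c * c = p * q" using assms by simp
  \<comment> \<open>A kernel vector of the singular system: \<open>(c, -p)\<close> in general; if
    \<open>p = 0\<close> then also \<open>c = 0\<close>, and \<open>(1, 0)\<close> works.\<close>
  have "\<exists>\<alpha> \<beta>. (\<alpha> \<noteq> 0 \<or> \<beta> \<noteq> 0) \<and> c * \<beta> + p * \<alpha> = 0 \<and> c * \<alpha> + q * \<beta> = 0"
  proof (cases "p = 0")
    case True
    then show ?thesis using c by (intro exI[of _ 1] exI[of _ 0]) auto
  next
    case False
    then show ?thesis using c by (intro exI[of _ c] exI[of _ "- p"]) auto
  qed
  then obtain \<alpha> \<beta> where ab: "\<alpha> \<noteq> 0 \<or> \<beta> \<noteq> 0" "c * \<beta> + p * \<alpha> = 0" "c * \<alpha> + q * \<beta> = 0" by blast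
  define f where "f j = complex_of_real (if even j then \<alpha> else \<beta>) * cis (\<kappa> * of_int j)" for j :: int
  have cis: "cis (\<kappa> * of_int (j + 1)) + cis (\<kappa> * of_int (j - 1)) = complex_of_real c * cis (\<kappa> * of_int j)" for j
    by (simp add: complex_eq_iff c_def cos_add sin_add cos_diff sin_diff algebra_simps)
  show thesis
  proof (rule that[of \<alpha> \<beta> f])
    show "cmod (f j) = (if even j then \<bar>\<alpha>\<bar> else \<bar>\<beta>\<bar>)" for j by (simp add: f_def norm_mult)
    show "schrod (\<lambda>j. if even j then p else q) f j = 0" for j
    proof (cases "even j")
      case True
      then have "schrod (\<lambda>j. if even j then p else q) f j
        = complex_of_real \<beta> * (cis (\<kappa> * of_int (j + 1)) + cis (\<kappa> * of_int (j - 1)))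
          + complex_of_real p * (complex_of_real \<alpha> * cis (\<kappa> * of_int j))"
        by (simp add: schrod_def f_def algebra_simps)
      also have "\<dots> = complex_of_real (c * \<beta> + p * \<alpha>) * cis (\<kappa> * of_int j)"
        unfolding cis by (simp add: algebra_simps)
      finally show ?thesis using ab by simp
    next
      case False
      then have "schrod (\<lambda>j. if even j then p else q) f j
        = complex_of_real \<alpha> * (cis (\<kappa> * of_int (j + 1)) + cis (\<kappa> * of_int (j - 1)))
          + complex_of_real q * (complex_of_real \<beta> * cis (\<kappa> * of_int j))"
        by (simp add: schrod_def f_def algebra_simps)
      also have "\<dots> = complex_of_real (c * \<alpha> + q * \<beta>) * cis (\<kappa> * of_int j)"
        unfolding cis by (simp add: algebra_simps)
      finally show ?thesis using ab by simp
    qed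
  qed (rule ab)
qed

text \<open>A Bloch wave cut off to a block of \<open>2 * L\<close> sites has squared norm at least
  a multiple of \<open>L\<close>, whereas its image lives on the four sites next to the cuts and is
  bounded independently of \<open>L\<close>. A bounded left inverse cannot exist.\<close>

lemma schrod_no_bounded_inverse:
  fixes W :: "int \<Rightarrow> real"
  assumes pq: "p * q \<in> {0..4}"
    and blocks: "\<And>L::nat. \<exists>m. \<forall>k<L. W (m + 2 * int k) = p \<and> W (m + 2 * int k + 1) = q"
  shows "\<not> has_bounded_inverse_l2 (schrod W)"
proof
  assume "has_bounded_inverse_l2 (schrod W)"
  then obtain G C where "\<forall>\<psi>\<in>l2. l2norm (G \<psi>) \<le> C * l2norm \<psi>" and inv: "\<forall>\<phi>\<in>l2. G (schrod W \<phi>) = \<phi>"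
    unfolding has_bounded_inverse_l2_def by blast
  then have C: "l2norm \<phi> \<le> C * l2norm (schrod W \<phi>)" if "\<phi> \<in> l2" "schrod W \<phi> \<in> l2" for \<phi>
    using that by metis
  obtain \<alpha> \<beta> f where ab: "\<alpha> \<noteq> 0 \<or> \<beta> \<noteq> 0" and fn: "\<And>j. cmod (f j) = (if even j then \<bar>\<alpha>\<bar> else \<bar>\<beta>\<bar>)"
    and f0: "\<And>j. schrod (\<lambda>j. if even j then p else q) f j = 0"
    using two_periodic_bloch_wave[OF pq] by metis
  define r where "r = \<bar>\<alpha>\<bar> + \<bar>\<beta>\<bar>"
  \<comment> \<open>A bound for the image at every site. Only the values \<open>p\<close> and
    \<open>q\<close> of \<open>W\<close> enter, because the truncated wave vanishes outside the
    block.\<close>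
  define R where "R = (2 + (\<bar>p\<bar> + \<bar>q\<bar>)) * r"
  \<comment> \<open>One of the two amplitudes may be zero; \<open>i\<close> selects a parity class
    on which the wave has positive modulus \<open>a\<close>.\<close>
  obtain i a where i: "i = 0 \<or> i = (1::int)" and a: "0 < a" and fi: "\<And>j. cmod (f (2 * j + i)) = a"
  proof (cases "\<alpha> = 0")
    case True then show thesis using ab fn by (intro that[of 1 "\<bar>\<beta>\<bar>"]) auto
  next
    case False then show thesis using ab fn by (intro that[of 0 "\<bar>\<alpha>\<bar>"]) auto
  qed
  have fr: "cmod (f j) \<le> r" for j by (simp add: fn r_def)
  have r0: "0 \<le> r" by (simp add: r_def)
  have "real L * a\<^sup>2 \<le> C\<^sup>2 * (4 * R\<^sup>2)" for L
  proof (cases "L = 0")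
    case False
    obtain m where m: "\<And>k. k < L \<Longrightarrow> W (m + 2 * int k) = p \<and> W (m + 2 * int k + 1) = q"
      using blocks by metis
    define I where "I = {m..<m + 2 * int L}"
    \<comment> \<open>The sites that feel the cuts: the two ends of the block and their outer
      neighbours. Everywhere else the Bloch equation holds or all terms vanish.\<close>
    define Q where "Q = {m - 1, m, m + 2 * int L - 1, m + 2 * int L}"
    define \<phi> where "\<phi> n = (if n \<in> I then f (n - m) else 0)" for n
    have WI: "W n = (if even (n - m) then p else q)" if "n \<in> I" for n
    proof -
      define k where "k = nat ((n - m) div 2)"
      have "k < L" "n = m + 2 * int k \<or> n = m + 2 * int k + 1"
        using that by (auto simp: k_def I_def)
      then show ?thesis using m[of k] by auto
    qed
    have \<phi>r: "cmod (\<phi> n) \<le> r" for n using fr r0 by (simp add: \<phi>_def)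
    have \<eta>0: "schrod W \<phi> n = 0" if "n \<notin> Q" for n
    proof (cases "n \<in> I")
      case True
      then have "n + 1 \<in> I" "n - 1 \<in> I" using that by (auto simp: I_def Q_def)
      then show ?thesis using f0[of "n - m"] WI[OF True] True
        by (simp add: schrod_def \<phi>_def algebra_simps)
    next
      case F: False
      then have "n + 1 \<notin> I" "n - 1 \<notin> I" using that by (auto simp: I_def Q_def)
      then show ?thesis using F by (simp add: schrod_def \<phi>_def)
    qed
    have \<eta>R: "cmod (schrod W \<phi> n) \<le> R" for n
    proof -
      have "cmod (W n * \<phi> n) \<le> (\<bar>p\<bar> + \<bar>q\<bar>) * r"
      proof (cases "n \<in> I")
        case True
        have "\<bar>W n\<bar> \<le> \<bar>p\<bar> + \<bar>q\<bar>" unfolding WI[OF True] by simp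
        then show ?thesis using \<phi>r[of n] by (simp add: norm_mult mult_mono)
      next
        case False then show ?thesis using r0 by (simp add: \<phi>_def)
      qed
      moreover have "cmod (schrod W \<phi> n) \<le> cmod (\<phi> (n + 1)) + cmod (\<phi> (n - 1)) + cmod (W n * \<phi> n)"
        unfolding schrod_def by (intro order_trans[OF norm_triangle_ineq] add_right_mono norm_triangle_ineq)
      ultimately show ?thesis using \<phi>r[of "n + 1"] \<phi>r[of "n - 1"] by (simp add: R_def algebra_simps)
    qed
    have "finite I" "\<And>n. n \<notin> I \<Longrightarrow> \<phi> n = 0" by (auto simp: I_def \<phi>_def)
    then have \<phi>: "\<phi> \<in> l2" "(l2norm \<phi>)\<^sup>2 = (\<Sum>n\<in>I. (cmod (\<phi> n))\<^sup>2)"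
      by (blast intro: l2_finite_support)+
    have "finite Q" by (simp add: Q_def)
    have \<eta>: "schrod W \<phi> \<in> l2" "(l2norm (schrod W \<phi>))\<^sup>2 = (\<Sum>n\<in>Q. (cmod (schrod W \<phi> n))\<^sup>2)"
      using l2_finite_support[of Q "schrod W \<phi>"] \<eta>0 \<open>finite Q\<close> by blast+
    have "card Q \<le> 4" unfolding Q_def by (intro order_trans[OF card_insert_le_m1]) auto
    have "(l2norm (schrod W \<phi>))\<^sup>2 \<le> real (card Q) * R\<^sup>2"
      unfolding \<eta> by (rule sum_bounded_above) (use \<eta>R in \<open>simp add: power_mono\<close>)
    also have "\<dots> \<le> 4 * R\<^sup>2" using \<open>card Q \<le> 4\<close> by (intro mult_right_mono) auto
    finally have \<eta>4: "(l2norm (schrod W \<phi>))\<^sup>2 \<le> 4 * R\<^sup>2" .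
    define J where "J = (\<lambda>k. m + (2 * int k + i)) ` {..<L}"
    have "real L * a\<^sup>2 = (\<Sum>n\<in>J. (cmod (\<phi> n))\<^sup>2)"
    proof -
      have "m + (2 * int k + i) \<in> I" if "k < L" for k using that i by (auto simp: I_def)
      then have "(\<Sum>k<L. (cmod (\<phi> (m + (2 * int k + i))))\<^sup>2) = (\<Sum>k<L. a\<^sup>2)"
        by (intro sum.cong) (auto simp: \<phi>_def fi)
      then show ?thesis unfolding J_def by (subst sum.reindex) (auto simp: inj_on_def)
    qed
    also have "\<dots> \<le> (l2norm \<phi>)\<^sup>2"
      unfolding \<phi>(2) by (rule sum_mono2) (use i in \<open>auto simp: I_def J_def\<close>)
    also have "\<dots> \<le> (C * l2norm (schrod W \<phi>))\<^sup>2"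
      by (rule power_mono[OF C[OF \<phi>(1) \<eta>(1)] l2norm_nonneg])
    also have "\<dots> \<le> C\<^sup>2 * (4 * R\<^sup>2)"
      unfolding power_mult_distrib using \<eta>4 by (rule mult_left_mono) simp
    finally show ?thesis .
  qed simp
  moreover obtain L where "C\<^sup>2 * (4 * R\<^sup>2) < real L * a\<^sup>2"
    using ex_less_of_nat_mult[of "a\<^sup>2" "C\<^sup>2 * (4 * R\<^sup>2)"] a by auto
  ultimately show False by (meson not_le)
qed

text \<open>The energy is absorbed into the potential, so that the criteria for
  \<open>schrod W\<close> apply with \<open>W n = V n - E\<close>.\<close>

lemma schrod_spectrum_eq:
  "schrod_spectrum V = {E. \<not> has_bounded_inverse_l2 (schrod (\<lambda>n. V n - E))}"
proof -
  have "(\<lambda>\<phi> n. schrod V \<phi> n - complex_of_real E * \<phi> n) = schrod (\<lambda>n. V n - E)" for E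
    by (auto simp: schrod_def fun_eq_iff algebra_simps)
  then show ?thesis by (simp add: schrod_spectrum_def)
qed

subsection \<open>The union of the periodic bands\<close>

text \<open>The equation \<open>(E - a) * (E - b) = 4 * (cos \<kappa>)\<^sup>2\<close> is the
  dispersion relation of the operator with alternating potential \<open>a\<close>, \<open>b\<close>;
  as \<open>\<kappa>\<close> varies, the right-hand side fills \<open>{0..4}\<close>.\<close>

definition band_union :: "real set \<Rightarrow> real set \<Rightarrow> real set" where
  "band_union A B = {E. \<exists>a\<in>A. \<exists>b\<in>B. (E - a) * (E - b) \<in> {0..4}}"

lemma compact_band_union:
  assumes "finite A" "finite B" shows "compact (band_union A B)"
proof -
  have e: "band_union A B = (\<Union>a\<in>A. \<Union>b\<in>B. {E. (E - a) * (E - b) \<in> {0..4}})"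
    by (auto simp: band_union_def)
  have "compact {E. (E - a) * (E - b) \<in> {0..4}}" for a b :: real
  proof (rule compact_eq_bounded_closed[THEN iffD2, OF conjI])
    show "closed {E. (E - a) * (E - b) \<in> {0..4}}"
      unfolding atLeastAtMost_iff
      by (intro closed_Collect_conj closed_Collect_le continuous_intros)
    show "bounded {E. (E - a) * (E - b) \<in> {0..4}}"
    \<comment> \<open>Outside this ball \<open>E\<close> is farther than 3 from both
      \<open>a\<close> and \<open>b\<close>, so the product exceeds 9 in absolute value.\<close>
    proof (rule bounded_subset[OF bounded_cball[of a "\<bar>a - b\<bar> + 3"]], safe)
      fix E assume E: "(E - a) * (E - b) \<in> {0..4}"
      show "E \<in> cball a (\<bar>a - b\<bar> + 3)"
      proof (rule ccontr)
        assume "E \<notin> cball a (\<bar>a - b\<bar> + 3)"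
        then have "3 < \<bar>E - a\<bar>" "3 < \<bar>E - b\<bar>" by (auto simp: dist_real_def)
        then have "3 * 3 < \<bar>E - a\<bar> * \<bar>E - b\<bar>" by (intro mult_strict_mono) auto
        then show False using E by (simp add: abs_mult[symmetric])
      qed
    qed
  qed
  then show ?thesis unfolding e using assms by (intro compact_UN) auto
qed

text \<open>A point of a band cannot lie strictly between \<open>a\<close> and \<open>b\<close>. On
  the way to the nearer of the two, both factors shrink in absolute value without changing sign, so
  the product stays in \<open>{0..4}\<close>.\<close>

lemma segment_in_band:
  fixes a b E :: real
  assumes "(E - a) * (E - b) \<in> {0..4}"
  shows "\<exists>s\<in>{a, b}. \<forall>z\<in>closed_segment s E. (z - a) * (z - b) \<in> {0..4}"
proof (cases "E \<ge> a \<and> E \<ge> b")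
  case True
  have "(z - a) * (z - b) \<in> {0..4}" if "z \<in> closed_segment (max a b) E" for z
  proof -
    have z: "a \<le> z" "b \<le> z" "z \<le> E" using that True by (auto simp: closed_segment_eq_real_ivl)
    then have "(z - a) * (z - b) \<le> (E - a) * (E - b)" by (intro mult_mono) auto
    then show ?thesis using z assms by auto
  qed
  then show ?thesis by (intro bexI[of _ "max a b"]) (auto simp: max_def)
next
  case False
  have le: "E \<le> a \<and> E \<le> b"
  proof (rule ccontr)
    assume "\<not> (E \<le> a \<and> E \<le> b)"
    then have "(E - a) * (E - b) < 0" using False by (auto simp: mult_less_0_iff)
    then show False using assms by auto
  qed
  have "(z - a) * (z - b) \<in> {0..4}" if "z \<in> closed_segment (min a b) E" for z
  proof -
    have z: "z \<le> a" "z \<le> b" "E \<le> z" using that le by (auto simp: closed_segment_eq_real_ivl split: if_splits)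
    then have "(a - z) * (b - z) \<le> (a - E) * (b - E)" by (intro mult_mono) auto
    moreover have "0 \<le> (a - z) * (b - z)" using z by simp
    ultimately show ?thesis using assms by (simp add: algebra_simps)
  qed
  then show ?thesis by (intro bexI[of _ "min a b"]) (auto simp: min_def)
qed

text \<open>By \<open>segment_in_band\<close> every point is joined within the union to an element
  of \<open>A \<union> B\<close>. Components are thus counted by these points and not by the
  individual bands.\<close>

lemma band_union_components:
  assumes "A \<noteq> {}" "B \<noteq> {}"
  shows "band_union A B = (\<Union>s\<in>A \<union> B. connected_component_set (band_union A B) s)"
proof (intro equalityI subsetI)
  fix E assume "E \<in> band_union A B"
  then obtain a b where ab: "a \<in> A" "b \<in> B" "(E - a) * (E - b) \<in> {0..4}"
    by (auto simp: band_union_def)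
  then obtain s where s: "s \<in> {a, b}" "\<And>z. z \<in> closed_segment s E \<Longrightarrow> (z - a) * (z - b) \<in> {0..4}"
    using segment_in_band by metis
  have "closed_segment s E \<subseteq> connected_component_set (band_union A B) s"
    by (rule connected_component_maximal) (use s ab in \<open>auto simp: band_union_def\<close>)
  then show "E \<in> (\<Union>s\<in>A \<union> B. connected_component_set (band_union A B) s)" using s ab by auto
qed (use connected_component_subset in blast)

lemma band_union_component_interval:
  assumes "finite A" "finite B" "A \<noteq> {}" "B \<noteq> {}" "s \<in> A \<union> B"
  shows "\<exists>l r. l \<le> r \<and> connected_component_set (band_union A B) s = {l..r}"
proof -
  let ?K = "connected_component_set (band_union A B) s"
  \<comment> \<open>Pairing \<open>s\<close> with any element of the other set makes the product
    zero.\<close>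
  have "s \<in> band_union A B" using assms by (fastforce simp: band_union_def)
  then have s: "s \<in> ?K" by simp
  have c: "compact (band_union A B)" by (rule compact_band_union[OF assms(1,2)])
  have "compact ?K"
    unfolding compact_eq_bounded_closed
    by (intro conjI bounded_subset[OF compact_imp_bounded[OF c] connected_component_subset]
        closed_connected_component compact_imp_closed[OF c])
  then obtain l r where "?K = {l..r}"
    using connected_compact_interval_1[of ?K] connected_connected_component by (auto simp: cbox_interval)
  with s show ?thesis by (metis atLeastAtMost_iff order_trans)
qed

subsection \<open>The almost sure spectrum\<close>

text \<open>Disjoint blocks of length \<open>N\<close> are independent, and each shows the pattern
  with probability at least \<open>\<delta> ^ N\<close>. All of the first \<open>R\<close> blocks
  fail with probability at most \<open>(1 - \<delta> ^ N) ^ R\<close>, which tends to 0.\<close>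

lemma (in prob_space) AE_pattern_in_some_block:
  fixes \<xi> :: "int \<Rightarrow> 'a \<Rightarrow> real" and g :: "int \<Rightarrow> real"
  assumes indep: "indep_vars (\<lambda>_. borel) \<xi> UNIV" and \<delta>: "0 < \<delta>"
    and likely: "\<And>n. \<delta> \<le> prob {\<omega> \<in> space M. \<xi> n \<omega> = g n}" and N: "0 < N"
  shows "AE \<omega> in M. \<exists>r::nat. \<forall>n\<in>{int (r * N)..<int (Suc r * N)}. \<xi> n \<omega> = g n"
proof -
  define K where "K r = {int (r * N)..<int (Suc r * N)}" for r
  define X where "X r \<omega> = restrict (\<lambda>n. \<xi> n \<omega>) (K r)" for r \<omega>
  \<comment> \<open>Failure of the pattern on block \<open>r\<close>, as a measurable set in the
    product space of that block; in this form independence of the block variables \<open>X r\<close>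
    applies.\<close>
  define A where "A r = space (PiM (K r) (\<lambda>_. borel)) - PiE (K r) (\<lambda>n. {g n})" for r
  have finK: "finite (K r)" for r by (simp add: K_def)
  have cardK: "card (K r) = N" for r by (simp add: K_def)
  have neK: "K r \<noteq> {}" for r using cardK[of r] N by auto
  have disj: "disjoint_family_on K UNIV"
  proof -
    have "K r \<inter> K s = {}" if "r < s" for r s
    proof -
      have "Suc r * N \<le> s * N" using that by (intro mult_right_mono) auto
      then have "int (Suc r * N) \<le> int (s * N)" by (simp only: of_nat_le_iff)
      then show ?thesis by (auto simp: K_def simp del: of_nat_mult)
    qed
    then show ?thesis unfolding disjoint_family_on_def by (metis Int_commute linorder_neqE_nat)
  qed
  have X: "indep_vars (\<lambda>r. PiM (K r) (\<lambda>_. borel)) X UNIV"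
    using indep_vars_restrict[OF indep, of UNIV K] disj unfolding X_def by simp
  have A: "A r \<in> sets (PiM (K r) (\<lambda>_. borel))" for r
    unfolding A_def by (intro sets.Diff sets.top sets_PiM_I_finite finK) simp
  have Xrv: "X r \<in> measurable M (PiM (K r) (\<lambda>_. borel))" for r
    using X by (simp add: indep_vars_def)
  have XA: "X r -` A r \<inter> space M = space M - (\<Inter>n\<in>K r. \<xi> n -` {g n} \<inter> space M)" for r
  proof -
    have "X r \<omega> \<in> A r \<longleftrightarrow> \<not> (\<forall>n\<in>K r. \<xi> n \<omega> = g n)" for \<omega>
      by (auto simp: A_def X_def space_PiM PiE_iff)
    then show ?thesis using neK[of r] by auto
  qed
  have le: "prob (X r -` A r \<inter> space M) \<le> 1 - \<delta> ^ N" for r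
  proof -
    have ev: "\<xi> n -` {g n} \<inter> space M \<in> events" for n
      using indep by (intro measurable_sets[of _ _ borel]) (auto simp: indep_vars_def)
    have eq: "\<xi> n -` {g n} \<inter> space M = {\<omega> \<in> space M. \<xi> n \<omega> = g n}" for n by auto
    have "\<delta> ^ N = (\<Prod>n\<in>K r. \<delta>)" by (simp add: cardK)
    also have "\<dots> \<le> (\<Prod>n\<in>K r. prob (\<xi> n -` {g n} \<inter> space M))"
      by (rule prod_mono) (use likely \<delta> eq in auto)
    also have "\<dots> = prob (\<Inter>n\<in>K r. \<xi> n -` {g n} \<inter> space M)"
      by (rule indep_varsD[OF indep neK finK, symmetric]) auto
    finally show ?thesis
      unfolding XA using sets.finite_INT[OF finK neK ev] by (subst prob_compl) auto
  qed
  define Bad where "Bad = (\<Inter>r. X r -` A r \<inter> space M)"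
  have XAev: "X r -` A r \<inter> space M \<in> events" for r by (rule measurable_sets[OF Xrv A])
  have Badev: "Bad \<in> events" unfolding Bad_def using XAev by (intro sets.countable_INT) auto
  have "prob Bad \<le> (1 - \<delta> ^ N) ^ R" if "0 < R" for R
  proof -
    have "prob Bad \<le> prob (\<Inter>r\<in>{..<R}. X r -` A r \<inter> space M)"
      using that XAev by (intro finite_measure_mono sets.finite_INT) (auto simp: Bad_def)
    also have "\<dots> = (\<Prod>r\<in>{..<R}. prob (X r -` A r \<inter> space M))"
      by (rule indep_varsD[OF X]) (use that A in auto)
    also have "\<dots> \<le> (\<Prod>r\<in>{..<R}. 1 - \<delta> ^ N)" by (rule prod_mono) (use le in auto)
    finally show ?thesis by simp
  qed
  moreover have "(\<lambda>R. (1 - \<delta> ^ N) ^ R) \<longlonglongrightarrow> 0"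
  proof (rule LIMSEQ_realpow_zero)
    show "0 \<le> 1 - \<delta> ^ N" using order_trans[OF measure_nonneg le] .
    show "1 - \<delta> ^ N < 1" using \<delta> by simp
  qed
  \<comment> \<open>The bound was derived for a nonempty collection of blocks, hence the eventual
    statement starts at 1.\<close>
  ultimately have "prob Bad \<le> 0"
    by (intro tendsto_lowerbound) (auto simp: eventually_sequentially intro!: exI[of _ 1])
  then have "Bad \<in> null_sets M"
    using Badev measure_nonneg[of M Bad] by (intro null_setsI) (auto simp: emeasure_eq_measure)
  then show ?thesis
  proof (rule AE_I')
    have "\<omega> \<in> Bad" if "\<omega> \<in> space M" "\<not> (\<exists>r. \<forall>n\<in>K r. \<xi> n \<omega> = g n)" for \<omega>
      using that unfolding Bad_def XA by auto
    then show "{\<omega> \<in> space M. \<not> (\<exists>r. \<forall>n\<in>{int (r * N)..<int (Suc r * N)}. \<xi> n \<omega> = g n)} \<subseteq> Bad"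
      unfolding K_def by blast
  qed
qed

text \<open>The deterministic core: band energies are spectral because of the long periodic blocks,
  and all others are not, because any two neighbouring sites carry one value from \<open>A\<close>
  and one from \<open>B\<close>.\<close>

lemma schrod_spectrum_eq_band_union:
  fixes V :: "int \<Rightarrow> real"
  assumes fin: "finite A" "finite B"
    and even: "\<And>n. even n \<Longrightarrow> V n \<in> A" and odd: "\<And>n. odd n \<Longrightarrow> V n \<in> B"
    and blocks: "\<And>a b (L::nat). a \<in> A \<Longrightarrow> b \<in> B \<Longrightarrow>
      \<exists>m. \<forall>k<L. V (m + 2 * int k) = a \<and> V (m + 2 * int k + 1) = b"
  shows "schrod_spectrum V = band_union A B"
proof (rule set_eqI)
  fix E
  show "E \<in> schrod_spectrum V \<longleftrightarrow> E \<in> band_union A B"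
  proof
    assume "E \<in> band_union A B"
    then obtain a b where ab: "a \<in> A" "b \<in> B" "(E - a) * (E - b) \<in> {0..4}"
      by (auto simp: band_union_def)
    have "\<not> has_bounded_inverse_l2 (schrod (\<lambda>n. V n - E))"
    proof (rule schrod_no_bounded_inverse)
      show "(a - E) * (b - E) \<in> {0..4}" using ab(3) by (simp add: algebra_simps)
      show "\<exists>m. \<forall>k<L. V (m + 2 * int k) - E = a - E \<and> V (m + 2 * int k + 1) - E = b - E" for L
        using blocks[OF ab(1,2), of L] by simp
    qed
    then show "E \<in> schrod_spectrum V" by (simp add: schrod_spectrum_eq)
  next
    assume E: "E \<in> schrod_spectrum V"
    show "E \<in> band_union A B"
    proof (rule ccontr)
      assume *: "E \<notin> band_union A B"
      have "range V \<subseteq> A \<union> B" using even odd by blast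
      then have "finite (range V)" using fin by (meson finite_UnI finite_subset)
      then have "finite (range (\<lambda>n. V n - E))"
        using finite_imageI[of "range V" "\<lambda>x. x - E"] by (simp add: image_image)
      moreover have "(V n - E) * (V (n + 1) - E) \<notin> {0..4}" for n
      proof (cases "even n")
        case True
        then have "V n \<in> A" "V (n + 1) \<in> B" by (auto intro: even odd)
        then have "(E - V n) * (E - V (n + 1)) \<notin> {0..4}" using * unfolding band_union_def by blast
        then show ?thesis by (simp add: algebra_simps)
      next
        case False
        then have "V (n + 1) \<in> A" "V n \<in> B" by (auto intro: even odd)
        then have "(E - V (n + 1)) * (E - V n) \<notin> {0..4}" using * unfolding band_union_def by blast
        then show ?thesis by (simp add: algebra_simps)
      qed
      ultimately have "has_bounded_inverse_l2 (schrod (\<lambda>n. V n - E))"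
        by (rule schrod_has_bounded_inverse)
      with E show False by (simp add: schrod_spectrum_eq)
    qed
  qed
qed

theorem theorem1:
  fixes M :: "'a measure" and \<xi> :: "int \<Rightarrow> 'a \<Rightarrow> real"
    and lam0 lam1 c0 c1 p0 p1 :: real
  assumes "prob_space M"
    and "p0 \<in> {0<..<1}" and "p1 \<in> {0<..<1}"
    and "prob_space.indep_vars M (\<lambda>_. borel) \<xi> UNIV"
    and "\<And>n. even n \<Longrightarrow> measure M {\<omega> \<in> space M. \<xi> n \<omega> = 1} = p0
                      \<and> measure M {\<omega> \<in> space M. \<xi> n \<omega> = 0} = 1 - p0"
    and "\<And>n. odd n \<Longrightarrow> measure M {\<omega> \<in> space M. \<xi> n \<omega> = 1} = p1
                      \<and> measure M {\<omega> \<in> space M. \<xi> n \<omega> = 0} = 1 - p1"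
  shows "\<exists>S :: real set.
           (AE \<omega> in M. schrod_spectrum
               (\<lambda>n. if even n then lam0 * \<xi> n \<omega> + c0 else lam1 * \<xi> n \<omega> + c1) = S)
         \<and> (\<exists>k::nat. \<exists>a b :: nat \<Rightarrow> real. k \<le> 4 \<and> (\<forall>i<k. a i \<le> b i)
               \<and> S = (\<Union>i<k. {a i..b i}))"
proof -
  interpret prob_space M by fact
  note indep = assms(4)
  define A where "A = {c0, c0 + lam0}"
  define B where "B = {c1, c1 + lam1}"
  define V where "V \<omega> n = (if even n then lam0 * \<xi> n \<omega> + c0 else lam1 * \<xi> n \<omega> + c1)" for \<omega> and n :: int
  have rv: "\<xi> n \<in> borel_measurable M" for n using indep by (simp add: indep_vars_def)
  \<comment> \<open>At each site the two atoms carry total mass 1, and the countably many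
    exceptional null sets are united.\<close>
  have bernoulli: "AE \<omega> in M. \<forall>n. \<xi> n \<omega> \<in> {0, 1}"
  proof (rule AE_all_countable[THEN iffD2], rule allI)
    fix n
    have ev: "{\<omega> \<in> space M. \<xi> n \<omega> = x} \<in> events" for x
      using measurable_sets[OF rv, of "{x}" n] by (simp add: vimage_def Int_def conj_commute)
    have "prob {\<omega> \<in> space M. \<xi> n \<omega> = 1} + prob {\<omega> \<in> space M. \<xi> n \<omega> = 0} = 1"
      using assms(5,6)[of n] by (cases "even n") auto
    then have "prob ({\<omega> \<in> space M. \<xi> n \<omega> = 1} \<union> {\<omega> \<in> space M. \<xi> n \<omega> = 0}) = 1"
      by (subst finite_measure_Union) (auto simp: ev)
    from AE_prob_1[OF this] show "AE \<omega> in M. \<xi> n \<omega> \<in> {0, 1}" by (rule AE_mp) auto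
  qed
  \<comment> \<open>The least probability of any value at any site; it bounds the likelihood of all
    four patterns uniformly.\<close>
  define \<delta> where "\<delta> = Min {p0, 1 - p0, p1, 1 - p1}"
  have \<delta>: "0 < \<delta>" using assms(2,3) by (simp add: \<delta>_def)
  \<comment> \<open>The even block length makes each block start at an even site, so that the value
    for even sites comes first; \<open>Suc\<close> keeps the length positive for
    \<open>L = 0\<close>. Finitely many pairs \<open>i\<close>, \<open>j\<close> and countably many
    \<open>L\<close> leave one null set.\<close>
  have blocks: "AE \<omega> in M. \<forall>i\<in>{0, 1}. \<forall>j\<in>{0, 1}. \<forall>L.
    \<exists>r::nat. \<forall>n\<in>{int (r * (2 * Suc L))..<int (Suc r * (2 * Suc L))}. \<xi> n \<omega> = (if even n then i else j)"
  proof (intro AE_finite_allI AE_all_countable[THEN iffD2] allI AE_pattern_in_some_block indep)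
    fix i j :: real and n assume "i \<in> {0, 1}" "j \<in> {0, 1}"
    then show "\<delta> \<le> prob {\<omega> \<in> space M. \<xi> n \<omega> = (if even n then i else j)}"
      using assms(5,6)[of n] by (cases "even n") (auto simp: \<delta>_def)
  qed (use \<delta> in auto)
  have "AE \<omega> in M. schrod_spectrum (V \<omega>) = band_union A B"
    using bernoulli blocks
  proof eventually_elim
    case (elim \<omega>)
    show ?case
    proof (rule schrod_spectrum_eq_band_union)
      fix a b and L :: nat assume "a \<in> A" "b \<in> B"
      have "A = (\<lambda>i. lam0 * i + c0) ` {0, 1}" "B = (\<lambda>j. lam1 * j + c1) ` {0, 1}"
        by (auto simp: A_def B_def)
      with \<open>a \<in> A\<close> \<open>b \<in> B\<close>
      obtain i j where ij: "i \<in> {0, 1}" "j \<in> {0, 1}" "a = lam0 * i + c0" "b = lam1 * j + c1"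
        by blast
      obtain r where r: "\<And>n. n \<in> {int (r * (2 * Suc L))..<int (Suc r * (2 * Suc L))} \<Longrightarrow>
          \<xi> n \<omega> = (if even n then i else j)"
        using elim(2) ij(1,2) by meson
      have "V \<omega> (int (r * (2 * Suc L)) + 2 * int k) = a \<and> V \<omega> (int (r * (2 * Suc L)) + 2 * int k + 1) = b"
        if "k < L" for k
        using r[of "int (r * (2 * Suc L)) + 2 * int k"] r[of "int (r * (2 * Suc L)) + 2 * int k + 1"] that ij
        by (simp add: V_def algebra_simps)
      then show "\<exists>m. \<forall>k<L. V \<omega> (m + 2 * int k) = a \<and> V \<omega> (m + 2 * int k + 1) = b" by blast
    next
      show "V \<omega> n \<in> A" if "even n" for n using elim(1)[rule_format, of n] that by (auto simp: V_def A_def)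
      show "V \<omega> n \<in> B" if "odd n" for n using elim(1)[rule_format, of n] that by (auto simp: V_def B_def)
    qed (simp_all add: A_def B_def)
  qed
  moreover have "\<exists>k::nat. \<exists>a b :: nat \<Rightarrow> real. k \<le> 4 \<and> (\<forall>i<k. a i \<le> b i)
               \<and> band_union A B = (\<Union>i<k. {a i..b i})"
  proof -
    have AB: "finite A" "finite B" "A \<noteq> {}" "B \<noteq> {}" by (auto simp: A_def B_def)
    \<comment> \<open>Enumerates the at most four anchor points by \<open>i < 4\<close>. Repetitions
      are harmless, since coinciding components only repeat an interval in the union; hence
      \<open>k\<close> is always taken to be 4.\<close>
    define xs where "xs = [c0, c0 + lam0, c1, c1 + lam1]"
    have xs: "A \<union> B = (!) xs ` {..<4}"
      unfolding A_def B_def xs_def by (auto simp: lessThan_Suc numeral_eq_Suc)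
    obtain l r where lr: "\<And>s. s \<in> A \<union> B \<Longrightarrow> l s \<le> r s \<and> connected_component_set (band_union A B) s = {l s..r s}"
      using band_union_component_interval[OF AB] by metis
    have mem: "xs ! i \<in> A \<union> B" if "i < 4" for i using that unfolding xs by blast
    have "band_union A B = (\<Union>s\<in>A \<union> B. {l s..r s})"
      using band_union_components[OF AB(3,4)] lr by simp
    also have "\<dots> = (\<Union>i<4. {l (xs ! i)..r (xs ! i)})" unfolding xs by (simp only: image_image)
    finally show ?thesis using lr mem
      by (intro exI[of _ 4] exI[of _ "\<lambda>i. l (xs ! i)"] exI[of _ "\<lambda>i. r (xs ! i)"]) auto
  qed
  ultimately show ?thesis unfolding V_def by blast
qed

end
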